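(* The congruence $$\sum_{k=1}^{n-1}\frac{2^{kn}-1}{2^k-1}\equiv 0\pmod{2^n-1}$$ holds true if and only if $n$ is prime.
   Context: Here $n$ denotes a positive integer. Each quotient $\frac{2^{kn}-1}{2^k-1}$ is an integer, since $2^k-1$ divides $2^{kn}-1$.
   Formalization: The formal theorem assumes n ≥ 2; for n = 1 the sum is empty and the modulus is 1, so the congruence holds although 1 is not prime. *)

theory Defs
  imports "HOL-Number_Theory.Cong" "HOL-Computational_Algebra.Primes"
begin

end

theory Submission
  imports Defs Complex_Main "HOL-Number_Theory.Pocklington"
    "HOL-Computational_Algebra.Polynomial"
begin

text \<open>
  Let \<open>p\<close> be a prime dividing \<open>2\<^sup>n - 1\<close>, so that \<open>t = ord p 2\<close> divides \<open>n\<close>. Comparing leading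
  \<open>p\<close>-adic terms, the congruence forces \<open>p\<close> to divide \<open>n / t - 1\<close>. As \<open>t < p\<close>, it follows that
  \<open>2\<^sup>n - 1\<close> is coprime to \<open>n\<close>. This removes the exceptional prime from Zsigmondy's theorem:
  for \<open>d\<close> dividing \<open>n\<close>, the primitive part of \<open>2\<^sup>d - 1\<close> is the value of the \<open>d\<close>-th cyclotomic
  polynomial at 2, whose absolute value exceeds 1 for \<open>d \<ge> 2\<close> because every factor \<open>2 - \<zeta>\<close> does.
  If \<open>n = d c\<close> with \<open>1 < c \<le> d\<close>, there is thus a prime \<open>p\<close> with \<open>ord p 2 = d\<close>; it divides \<open>c - 1\<close>,
  which contradicts \<open>p > d \<ge> c\<close>.
\<close>

section \<open>Geometric sums modulo prime powers\<close>

lemma geometric_sum_cong: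
  fixes z :: int
  assumes "[z = 1] (mod p)"
  shows "[(\<Sum>j<n. z ^ j) = int n] (mod p)"
proof -
  have "[(\<Sum>j<n. z ^ j) = (\<Sum>j<n. 1 ^ j)] (mod p)"
    by (intro cong_sum cong_pow assms)
  thus ?thesis by simp
qed

text \<open>Writing \<open>z = 1 + p y\<close>, only the linear term of \<open>z ^ j\<close>
  survives modulo the square of \<open>p\<close>. These terms add up to \<open>p y\<close> times
  \<open>p (p - 1) / 2\<close>, where oddness of \<open>p\<close> makes the half an integer.\<close>

lemma geometric_sum_cong_square:
  fixes z :: int and p :: nat
  assumes "odd p" "[z = 1] (mod int p)"
  shows "[(\<Sum>j<p. z ^ j) = int p] (mod (int p)\<^sup>2)"
proof -
  obtain y where y: "z = 1 + int p * y"
    using assms(2) by (metis cong_iff_lin cong_sym)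
  have pow: "[z ^ j = 1 + int p * y * int j] (mod (int p)\<^sup>2)" for j
  proof (induction j)
    case (Suc j)
    have "[z * z ^ j = z * (1 + int p * y * int j)] (mod (int p)\<^sup>2)"
      using Suc by (rule cong_scalar_left)
    also have "z * (1 + int p * y * int j) = 1 + int p * y * int (Suc j) + (int p)\<^sup>2 * (y\<^sup>2 * int j)"
      unfolding y by (simp add: algebra_simps power2_eq_square)
    also have "[\<dots> = 1 + int p * y * int (Suc j)] (mod (int p)\<^sup>2)"
      by (simp add: cong_iff_dvd_diff)
    finally show ?case by simp
  qed simp
  have "[(\<Sum>j<p. z ^ j) = (\<Sum>j<p. 1 + int p * y * int j)] (mod (int p)\<^sup>2)"
    by (intro cong_sum pow)
  also have "(\<Sum>j<p. 1 + int p * y * int j) = int p + int p * y * int (\<Sum>j<p. j)"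
    by (simp add: sum.distrib sum_distrib_left)
  also have "(\<Sum>j<p. j) = p * ((p - 1) div 2)"
  proof -
    from \<open>odd p\<close> obtain k where "p = Suc (2 * k)" by (metis oddE Suc_eq_plus1)
    moreover have "(\<Sum>j<Suc m. j) = m * Suc m div 2" for m :: nat
      using gauss_sum_nat[of m] by (simp add: atMost_atLeast0 lessThan_Suc_atMost)
    ultimately show ?thesis by (simp del: sum.lessThan_Suc)
  qed
  also have "[int p + int p * y * int (p * ((p - 1) div 2)) = int p] (mod (int p)\<^sup>2)"
    by (simp add: cong_iff_dvd_diff power2_eq_square)
  finally show ?thesis .
qed

text \<open>The exponents below \<open>a * b\<close> are cut into \<open>b\<close> consecutive
  blocks of length \<open>a\<close>.\<close>

lemma geometric_sum_mult:
  fixes z :: int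
  shows "(\<Sum>j<a * b. z ^ j) = (\<Sum>j<a. z ^ j) * (\<Sum>j<b. (z ^ a) ^ j)"
proof (induction b)
  case (Suc b)
  have "(\<Sum>j<a * Suc b. z ^ j) = (\<Sum>j<a * b. z ^ j) + (\<Sum>j<a. z ^ (a * b + j))"
    using sum.nat_group[of "\<lambda>j. z ^ j" a b] sum.nat_group[of "\<lambda>j. z ^ j" a "Suc b"]
      sum.shift_bounds_nat_ivl[of "\<lambda>j. z ^ j" 0 "b * a" a]
    by (simp add: mult.commute atLeast0LessThan add.commute)
  thus ?case
    by (simp add: Suc distrib_left power_add power_mult sum_distrib_left sum_distrib_right mult.commute)
qed simp

text \<open>An additive form of lifting the exponent. Each step of the induction splits one factor
  \<open>p\<close> off \<open>n\<close>: the block of length \<open>p\<close> contributes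
  \<open>p\<close> up to a multiple of its square, and the sum in \<open>z ^ p\<close> is handled by
  the induction hypothesis.\<close>

lemma geometric_sum_cong_prime_power:
  fixes z :: int and p :: nat
  assumes "odd p" "[z = 1] (mod int p)" "p ^ a dvd n"
  shows "[(\<Sum>j<n. z ^ j) = int n] (mod int p ^ Suc a)"
  using assms(2,3)
proof (induction a arbitrary: n z)
  case 0
  thus ?case using geometric_sum_cong by simp
next
  case (Suc a)
  obtain e where e: "n = p ^ Suc a * e" using Suc.prems(2) by (rule dvdE)
  define m where "m = p ^ a * e"
  have n: "n = p * m" and m: "p ^ a dvd m" by (simp_all add: e m_def)
  obtain c where c: "int m = int p ^ a * c"
    using m by (metis dvdE of_nat_mult of_nat_power)
  have "[z ^ p = 1] (mod int p)"
    using cong_pow[OF Suc.prems(1), of p] by simp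
  from Suc.IH[OF this m] obtain r where r: "(\<Sum>j<m. (z ^ p) ^ j) = int m + int p ^ Suc a * r"
    by (metis cong_iff_lin cong_sym)
  obtain s where s: "(\<Sum>j<p. z ^ j) = int p + (int p)\<^sup>2 * s"
    using geometric_sum_cong_square[OF \<open>odd p\<close> Suc.prems(1)] by (metis cong_iff_lin cong_sym)
  \<comment> \<open>The difference is \<open>(p + p^2 s) (m + p^(a+1) r) - p m\<close>; substituting
    \<open>p^a c\<close> for \<open>m\<close> in the term \<open>p^2 s m\<close> exposes the common
    power of \<open>p\<close>.\<close>
  have "(\<Sum>j<n. z ^ j) - int n = int p ^ Suc (Suc a) * (r + s * c + int p * s * r)"
    unfolding n geometric_sum_mult r s by (simp add: c algebra_simps power2_eq_square)
  thus ?case by (simp add: cong_iff_dvd_diff)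
qed

section \<open>The order of 2 modulo a divisor of \<open>2 ^ k - 1\<close>\<close>

text \<open>Even \<open>p\<close> fits in as well: then \<open>ord p 2 = 0\<close>, which divides
  only \<open>k = 0\<close>, and \<open>2 ^ k - 1\<close> is odd for all other
  \<open>k\<close>.\<close>

lemma dvd_pow2_minus_1_iff:
  fixes p :: nat
  shows "p dvd 2 ^ k - 1 \<longleftrightarrow> ord p 2 dvd k"
proof -
  have "[2 ^ k = 1] (mod p) \<longleftrightarrow> p dvd 2 ^ k - 1"
    by (metis cong_altdef_nat cong_sym_eq one_le_numeral one_le_power)
  thus ?thesis by (simp only: ord_divides)
qed

lemma int_dvd_pow2_minus_1_iff:
  fixes p :: nat
  shows "int p dvd 2 ^ k - 1 \<longleftrightarrow> ord p 2 dvd k"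
proof -
  have "int p dvd int (2 ^ k - 1) \<longleftrightarrow> ord p 2 dvd k"
    by (simp only: int_dvd_int_iff dvd_pow2_minus_1_iff)
  thus ?thesis by (simp add: of_nat_diff)
qed

lemma ord_two_less:
  fixes p :: nat
  assumes "prime p" "odd p"
  shows "0 < ord p 2" "ord p 2 < p"
proof -
  have cop: "coprime p 2" using assms by simp
  thus "0 < ord p 2" by simp
  have "ord p 2 dvd p - 1"
    using order_divides_totient[of p 2] cop assms by (simp add: totient_prime)
  moreover have "p - 1 > 0" using prime_gt_1_nat[OF assms(1)] by simp
  ultimately show "ord p 2 < p" by (auto dest!: dvd_imp_le)
qed

section \<open>The quotients and the \<open>p\<close>-adic leading term of their sum\<close>

lemma pow2_mult_minus_1:
  "(2::int) ^ (k * n) - 1 = (2 ^ k - 1) * (\<Sum>j<n. (2 ^ k) ^ j)"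
  unfolding power_mult by (rule power_diff_1_eq)

lemma pow2_quotient:
  assumes "k > 0"
  shows "((2::int) ^ (k * n) - 1) div (2 ^ k - 1) = (\<Sum>j<n. (2 ^ k) ^ j)"
proof -
  have "(2::int) ^ k > 1" using assms by simp
  hence "(2::int) ^ k - 1 \<noteq> 0" by linarith
  thus ?thesis unfolding pow2_mult_minus_1 by (rule nonzero_mult_div_cancel_left)
qed

lemma dvd_pow2_mult_minus_1: "(2::int) ^ n - 1 dvd 2 ^ (n * k) - 1"
  unfolding pow2_mult_minus_1 by simp

text \<open>All quotients with \<open>ord p 2\<close> dividing \<open>k\<close> have the same leading \<open>p\<close>-adic term \<open>n\<close>, and the
  others vanish to that precision, so the sum is \<open>n (n / ord p 2 - 1)\<close> modulo \<open>p n\<close>, \<open>p\<close>-adically.\<close>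

lemma prime_dvd_index_minus_1:
  fixes p n :: nat
  assumes cong: "[(\<Sum>k = 1..n - 1. (2 ^ (k * n) - 1) div (2 ^ k - 1)) = (0 :: int)] (mod (2 ^ n - 1))"
    and p: "prime p" "odd p" and n: "n = ord p 2 * m" "n > 0"
  shows "p dvd m - 1"
proof -
  define t where "t = ord p 2"
  define a where "a = multiplicity p n"
  have t: "0 < t" "t < p" using ord_two_less[OF p] by (auto simp: t_def)
  have nt: "n = t * m" using n t_def by simp
  have m: "m > 0" using n by (cases m) auto
  have pan: "p ^ a dvd n" by (simp add: a_def multiplicity_dvd)
  have one: "[2 ^ k = 1] (mod int p)" if "t dvd k" for k
    using that int_dvd_pow2_minus_1_iff[of p k] by (simp add: cong_iff_dvd_diff t_def)
  have cop: "coprime p t"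
    using t p by (intro prime_imp_coprime) (auto dest: dvd_imp_le)
  hence "coprime (p ^ a) t" by simp
  hence pam: "p ^ a dvd m" using pan nt by (simp add: coprime_dvd_mult_right_iff)
  \<comment> \<open>One factor \<open>p\<close> comes from \<open>2 ^ t - 1\<close>, the other
    \<open>a\<close> from the cofactor, which is congruent to \<open>m\<close> and hence to 0 modulo
    \<open>p ^ a\<close>.\<close>
  have mod_dvd: "int p ^ Suc a dvd 2 ^ n - 1"
  proof -
    have "[(\<Sum>j<m. (2 ^ t) ^ j) = int m] (mod int p ^ Suc a)"
      by (rule geometric_sum_cong_prime_power) (use p one pam in auto)
    hence "[(\<Sum>j<m. (2 ^ t) ^ j) = int m] (mod int p ^ a)"
      by (rule cong_dvd_modulus) simp
    moreover have "int p ^ a dvd int m" using pam by (metis int_dvd_int_iff of_nat_power)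
    ultimately have "int p ^ a dvd (\<Sum>j<m. (2 ^ t) ^ j)" by (simp add: cong_dvd_iff)
    moreover have "int p dvd 2 ^ t - 1" using one[of t] by (simp add: cong_iff_dvd_diff)
    moreover have "(2::int) ^ n - 1 = (2 ^ t - 1) * (\<Sum>j<m. (2 ^ t) ^ j)"
      unfolding nt by (rule pow2_mult_minus_1)
    ultimately show ?thesis by (simp add: mult_dvd_mono)
  qed
  have term_cong: "[(2 ^ (k * n) - 1) div (2 ^ k - 1) = (if t dvd k then int n else 0)] (mod int p ^ Suc a)"
    if k: "k \<in> {1..n-1}" for k
  proof -
    have q: "((2::int) ^ (k * n) - 1) div (2 ^ k - 1) = (\<Sum>j<n. (2 ^ k) ^ j)"
      using k by (intro pow2_quotient) auto
    show ?thesis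
    proof (cases "t dvd k")
      case True
      thus ?thesis unfolding q
        using geometric_sum_cong_prime_power[OF p(2) one pan] by simp
    next
      case False
      hence "\<not> int p dvd 2 ^ k - 1" by (simp add: int_dvd_pow2_minus_1_iff t_def)
      hence "coprime (int p) (2 ^ k - 1)" using p by (intro prime_imp_coprime) auto
      hence c: "coprime (int p ^ Suc a) (2 ^ k - 1)" by simp
      \<comment> \<open>The product is \<open>2 ^ (k * n) - 1\<close>, a multiple of
        \<open>2 ^ n - 1\<close>; its first factor is prime to \<open>p\<close>, so the quotient
        absorbs the whole prime power.\<close>
      have "int p ^ Suc a dvd (2 ^ k - 1) * (\<Sum>j<n. (2 ^ k) ^ j)"
        using dvd_trans[OF mod_dvd dvd_pow2_mult_minus_1[of n k]]
        unfolding mult.commute[of n k] pow2_mult_minus_1[of k n] .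
      hence "int p ^ Suc a dvd (\<Sum>j<n. (2 ^ k) ^ j)"
        using c by (simp only: coprime_dvd_mult_right_iff)
      thus ?thesis unfolding q using False by (simp add: cong_0_iff)
    qed
  qed
  have "{k \<in> {1..n-1}. t dvd k} = (\<lambda>i. t * i) ` {1..m-1}"
  proof (intro equalityI subsetI)
    fix k assume "k \<in> {k \<in> {1..n-1}. t dvd k}"
    then obtain i where i: "k = t * i" "1 \<le> t * i" "t * i \<le> n - 1" by auto
    hence "t * i < t * m" using n(2) nt by linarith
    hence "i < m" by simp
    moreover have "i \<noteq> 0" using i(2) by (cases i) auto
    ultimately have "i \<in> {1..m-1}" by auto
    thus "k \<in> (\<lambda>i. t * i) ` {1..m-1}" using i by auto
  next
    fix k assume "k \<in> (\<lambda>i. t * i) ` {1..m-1}"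
    then obtain i where i: "k = t * i" "1 \<le> i" "i < m" using m by force
    hence "t * i < t * m" using t by simp
    hence "t * i \<le> n - 1" unfolding nt by linarith
    thus "k \<in> {k \<in> {1..n-1}. t dvd k}" using i t by auto
  qed
  hence card: "card {k \<in> {1..n-1}. t dvd k} = m - 1"
    using t by (simp add: card_image inj_on_def)
  have "[0 = (\<Sum>k = 1..n - 1. (2 ^ (k * n) - 1) div (2 ^ k - 1))] (mod int p ^ Suc a)"
    using cong_dvd_modulus[OF cong mod_dvd] by (rule cong_sym)
  also have "[(\<Sum>k = 1..n - 1. (2 ^ (k * n) - 1) div (2 ^ k - 1)) =
      (\<Sum>k = 1..n - 1. if t dvd k then int n else 0)] (mod int p ^ Suc a)"
    by (intro cong_sum term_cong)
  also have "(\<Sum>k = 1..n - 1. if t dvd k then int n else 0) = int ((m - 1) * n)"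
    using card by (simp add: sum.If_cases Int_def)
  finally have "int (p ^ Suc a) dvd int ((m - 1) * n)"
    by (simp add: cong_0_iff cong_sym_eq[of 0])
  hence dvd: "p ^ Suc a dvd (m - 1) * n" by (simp only: int_dvd_int_iff)
  \<comment> \<open>Exactly \<open>p ^ a\<close> cancels against \<open>n\<close>, so the one
    surplus factor \<open>p\<close> must divide \<open>m - 1\<close>.\<close>
  have "n \<noteq> 0" "\<not> is_unit p" using n(2) p(1) by auto
  then obtain c where c: "n = p ^ a * c" "\<not> p dvd c"
    unfolding a_def by (rule multiplicity_decompose')
  have "p dvd (m - 1) * c" using dvd p c(1) by (simp add: mult.left_commute prime_gt_0_nat)
  thus ?thesis using p c by (simp add: prime_dvd_mult_iff)
qed

section \<open>Roots of unity and cyclotomic values at 2\<close>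

text \<open>The multiplicative order of a root of unity; for any other \<open>z\<close> no
  \<open>j\<close> qualifies and the value carries no meaning.\<close>

definition root_order :: "complex \<Rightarrow> nat" where
  "root_order z = (LEAST j. j > 0 \<and> z ^ j = 1)"

lemma root_order:
  assumes "k > 0" "z ^ k = 1"
  shows "root_order z > 0" "z ^ root_order z = 1" "root_order z dvd k"
proof -
  have o: "root_order z > 0 \<and> z ^ root_order z = 1"
    using LeastI[of "\<lambda>j. j > 0 \<and> z ^ j = 1" k] assms by (simp add: root_order_def)
  thus "root_order z > 0" "z ^ root_order z = 1" by auto
  have "z ^ k = z ^ (root_order z * (k div root_order z) + k mod root_order z)" by simp
  also have "\<dots> = z ^ (k mod root_order z)" unfolding power_add power_mult using o by simp
  finally have "z ^ (k mod root_order z) = 1" using assms by simp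
  moreover have "k mod root_order z < root_order z" using o by simp
  ultimately have "k mod root_order z = 0"
    using not_less_Least[of "k mod root_order z" "\<lambda>j. j > 0 \<and> z ^ j = 1"]
    by (auto simp: root_order_def)
  thus "root_order z dvd k" by auto
qed

definition cyclotomic_at_2 :: "nat \<Rightarrow> complex" where
  "cyclotomic_at_2 d = (\<Prod>z | z ^ d = 1 \<and> root_order z = d. 2 - z)"

text \<open>Both sides are monic polynomials of degree \<open>n\<close> in \<open>x\<close> that
  agree at the \<open>n\<close> roots of unity, hence everywhere.\<close>

lemma prod_roots_unity:
  fixes x :: complex
  assumes "n > 0"
  shows "(\<Prod>z | z ^ n = 1. x - z) = x ^ n - 1"
proof -
  let ?A = "{z::complex. z ^ n = 1}"
  let ?q = "\<Prod>z\<in>?A. [:- z, 1:]"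
  have card: "card ?A = n" using assms by (rule card_roots_unity_eq)
  have fin: "finite ?A" using card assms card_ge_0_finite by metis
  have deg: "degree ?q = n" using card by (subst degree_prod_sum_eq) auto
  have "lead_coeff ?q = 1" by (subst lead_coeff_prod) simp
  hence "coeff ?q n = 1" using deg by simp
  have "?q = monom 1 n - 1"
  proof (rule poly_eqI_degree_lead_coeff[where A = ?A and n = n])
    show "coeff ?q n = coeff (monom 1 n - 1) n" using \<open>coeff ?q n = 1\<close> assms by simp
    show "degree (monom 1 n - 1 :: complex poly) \<le> n"
      by (intro degree_diff_le) (auto simp: degree_monom_le)
    show "poly ?q z = poly (monom 1 n - 1) z" if "z \<in> ?A" for z
    proof -
      have "(\<Prod>w\<in>?A. z - w) = 0" using that fin by (intro prod_zero) auto
      thus ?thesis using that by (simp add: poly_prod poly_monom)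
    qed
  qed (use card deg in auto)
  hence "poly ?q x = poly (monom 1 n - 1) x" by simp
  thus ?thesis by (simp add: poly_prod poly_monom)
qed

text \<open>The \<open>k\<close>-th roots of unity are grouped by their order.\<close>

lemma prod_cyclotomic_at_2:
  assumes "k > 0"
  shows "(\<Prod>d | d dvd k. cyclotomic_at_2 d) = 2 ^ k - 1"
proof -
  let ?A = "{z::complex. z ^ k = 1}"
  have fin: "finite ?A" using card_roots_unity_eq[OF assms] assms card_ge_0_finite by metis
  have "(2::complex) ^ k - 1 = (\<Prod>z\<in>?A. 2 - z)" using prod_roots_unity[OF assms] by simp
  also have "\<dots> = (\<Prod>d | d dvd k. \<Prod>z | z \<in> ?A \<and> root_order z = d. 2 - z)"
    using fin assms root_order[OF assms] by (intro prod.group[symmetric]) auto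
  also have "\<dots> = (\<Prod>d | d dvd k. cyclotomic_at_2 d)"
    unfolding cyclotomic_at_2_def
  proof (intro prod.cong refl)
    fix d assume "d \<in> {d. d dvd k}"
    thus "{z. z \<in> ?A \<and> root_order z = d} = {z. z ^ d = 1 \<and> root_order z = d}"
      using root_order(2)[OF assms] by (auto elim!: dvdE simp: power_mult)
  qed
  finally show ?thesis by simp
qed

lemma norm_cyclotomic_at_2_gt_1:
  assumes "d \<ge> 2"
  shows "norm (cyclotomic_at_2 d) > 1"
proof -
  let ?A = "{z::complex. z ^ d = 1 \<and> root_order z = d}"
  have d: "d > 0" using assms by simp
  have "finite {z::complex. z ^ d = 1}"
    using card_roots_unity_eq[OF d] d card_ge_0_finite by metis
  hence fin: "finite ?A" by (rule rev_finite_subset) auto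
  \<comment> \<open>A primitive \<open>d\<close>-th root of unity, showing that the product is not
    empty.\<close>
  define w where "w = cis (2 * pi / d)"
  have w: "w ^ j = cis (2 * pi * real j / real d)" for j
    by (simp add: w_def DeMoivre mult_ac)
  have "w ^ d = 1" using d by (simp add: w)
  moreover have "w ^ j \<noteq> 1" if "0 < j" "j < d" for j
  proof
    assume "w ^ j = 1"
    hence "cis (2 * pi * real j / real d) = cis (2 * pi * real 0 / real d)" by (simp add: w)
    with bij_betw_roots_unity[OF d] that d have "j = 0"
      by (auto simp: bij_betw_def inj_on_def)
    thus False using that by simp
  qed
  hence "\<not> root_order w < d"
    using root_order[OF d \<open>w ^ d = 1\<close>] by auto
  with root_order(3)[OF d \<open>w ^ d = 1\<close>] d have "root_order w = d"
    by (meson dvd_imp_le le_neq_implies_less)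
  ultimately have "w \<in> ?A" by simp
  hence ne: "?A \<noteq> {}" by blast
  \<comment> \<open>The unit circle meets the closed unit disc around 2 only in
    \<open>z = 1\<close>, whose order is 1 and not \<open>d\<close>.\<close>
  have "1 < norm (2 - z)" if "z \<in> ?A" for z
  proof -
    have "norm z = 1" using power_eq_1_iff[of z d] that d by auto
    have "z \<noteq> 1" using that assms root_order(3)[of 1 1] by auto
    show ?thesis
    proof (rule ccontr)
      assume "\<not> 1 < norm (2 - z)"
      hence "(norm (2 - z))\<^sup>2 \<le> 1" by (simp add: power_le_one)
      hence "(2 - Re z)\<^sup>2 + (Im z)\<^sup>2 \<le> 1" by (simp add: cmod_power2)
      moreover have c: "(Re z)\<^sup>2 + (Im z)\<^sup>2 = 1" using \<open>norm z = 1\<close> by (simp add: cmod_def)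
      moreover have "(2 - Re z)\<^sup>2 = 4 - 4 * Re z + (Re z)\<^sup>2" by (simp add: power2_diff)
      ultimately have "Re z \<ge> 1" by linarith
      hence "(Re z)\<^sup>2 \<ge> 1" by simp
      moreover have "(Im z)\<^sup>2 \<ge> 0" by simp
      ultimately have "(Im z)\<^sup>2 = 0" "(Re z)\<^sup>2 = 1" using c by linarith+
      hence "z = 1" using \<open>Re z \<ge> 1\<close> by (auto simp: complex_eq_iff power2_eq_1_iff)
      thus False using \<open>z \<noteq> 1\<close> by simp
    qed
  qed
  hence "1 < (\<Prod>z\<in>?A. norm (2 - z))" using fin ne by (intro less_1_prod) auto
  thus ?thesis by (simp add: cyclotomic_at_2_def prod_norm)
qed

section \<open>The primitive part of \<open>2 ^ d - 1\<close>\<close>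

text \<open>For \<open>d > 0\<close>, the primes kept divide \<open>2 ^ d - 1\<close> but no
  \<open>2 ^ j - 1\<close> with \<open>0 < j < d\<close>.\<close>

definition primitive_part :: "nat \<Rightarrow> nat" where
  "primitive_part d =
    (\<Prod>p | p \<in> prime_factors (2 ^ d - 1) \<and> ord p 2 = d. p ^ multiplicity p (2 ^ d - 1))"

text \<open>The cofactor of \<open>2 ^ d - 1\<close> in \<open>2 ^ k - 1\<close> is congruent to
  \<open>k / d\<close> modulo \<open>p\<close>, hence prime to \<open>p\<close>.\<close>

lemma multiplicity_pow2_minus_1:
  fixes p k d :: nat
  assumes "prime p" "\<not> p dvd k" "ord p 2 = d" "d dvd k" "d > 0"
  shows "multiplicity p (2 ^ k - 1) = multiplicity p (2 ^ d - 1)"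
proof -
  obtain m where m: "k = d * m" using assms by auto
  define s where "s = (\<Sum>j<m. (2 ^ d) ^ j :: nat)"
  have "int (2 ^ k - 1) = int ((2 ^ d - 1) * s)"
    using pow2_mult_minus_1[of d m] by (simp add: m s_def of_nat_diff)
  hence eq: "2 ^ k - 1 = (2 ^ d - 1) * s" by (simp only: of_nat_eq_iff)
  have "int p dvd 2 ^ d - 1" using assms by (simp add: int_dvd_pow2_minus_1_iff)
  hence "[2 ^ d = 1] (mod int p)" by (simp add: cong_iff_dvd_diff)
  hence "[int s = int m] (mod int p)" using geometric_sum_cong by (simp add: s_def)
  hence "p dvd s \<longleftrightarrow> p dvd m" by (metis cong_dvd_iff cong_int_iff)
  hence "\<not> p dvd s" using assms m by auto
  hence "s \<noteq> 0" "multiplicity p s = 0" by (auto intro: not_dvd_imp_multiplicity_0 intro!: Nat.gr0I)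
  moreover have "(2::nat) ^ d - 1 \<noteq> 0"
    using one_less_power[of "2::nat" d] assms(5) by linarith
  ultimately show ?thesis unfolding eq using assms
    by (subst prime_elem_multiplicity_mult_distrib) auto
qed

text \<open>Prime factors are grouped by the order of 2; coprimality keeps each multiplicity the
  same in \<open>2 ^ k - 1\<close> as in \<open>2 ^ d - 1\<close>.\<close>

lemma prod_primitive_part:
  assumes "k > 0" "coprime (2 ^ k - 1) k"
  shows "(\<Prod>d | d dvd k. primitive_part d) = 2 ^ k - 1"
proof -
  let ?A = "prime_factors (2 ^ k - 1 :: nat)"
  have pos: "(2::nat) ^ j - 1 \<noteq> 0" if "j > 0" for j
    using one_less_power[of "2::nat" j] that by linarith
  have A: "p \<in> prime_factors (2 ^ j - 1) \<longleftrightarrow> prime p \<and> ord p 2 dvd j" if "j > 0" for p j :: nat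
    using pos[OF that] dvd_pow2_minus_1_iff[of p j] by (auto simp: in_prime_factors_iff)
  have "2 ^ k - 1 = (\<Prod>p\<in>?A. p ^ multiplicity p (2 ^ k - 1))"
    using pos[OF assms(1)] by (subst prod_prime_factors) auto
  also have "\<dots> = (\<Prod>d | d dvd k. \<Prod>p | p \<in> ?A \<and> ord p 2 = d. p ^ multiplicity p (2 ^ k - 1))"
    using assms A[OF assms(1)] by (intro prod.group[symmetric]) auto
  also have "\<dots> = (\<Prod>d | d dvd k. primitive_part d)"
    unfolding primitive_part_def
  proof (intro prod.cong refl)
    fix d assume d: "d \<in> {d. d dvd k}"
    hence "d > 0" using assms by (auto intro!: Nat.gr0I)
    thus "{p. p \<in> ?A \<and> ord p 2 = d} = {p. p \<in> prime_factors (2 ^ d - 1) \<and> ord p 2 = d}"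
      using A[OF assms(1)] A[OF \<open>d > 0\<close>] d by auto
    fix p :: nat assume "p \<in> {p. p \<in> prime_factors (2 ^ d - 1) \<and> ord p 2 = d}"
    hence p: "prime p" "ord p 2 = d" by auto
    have "p dvd 2 ^ k - 1" using p d by (simp add: dvd_pow2_minus_1_iff del: One_nat_def)
    hence "\<not> p dvd k" using assms(2) p by (meson coprime_common_divisor not_prime_unit)
    thus "p ^ multiplicity p (2 ^ k - 1) = p ^ multiplicity p (2 ^ d - 1)"
      using multiplicity_pow2_minus_1[of p k d] p d \<open>d > 0\<close> by simp
  qed
  finally show ?thesis by simp
qed

section \<open>Existence of a primitive prime divisor\<close>

text \<open>The uniqueness half of multiplicative Moebius inversion: by strong induction the factors
  at proper divisors agree, and their product is nonzero and cancels.\<close>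

lemma divisor_prod_unique:
  fixes f g :: "nat \<Rightarrow> 'a::field"
  assumes "\<And>k. k dvd n \<Longrightarrow> (\<Prod>d | d dvd k. f d) = (\<Prod>d | d dvd k. g d)"
    and "\<And>k. k dvd n \<Longrightarrow> (\<Prod>d | d dvd k. f d) \<noteq> 0"
    and "n > 0" "k dvd n"
  shows "f k = g k"
  using assms(4)
proof (induction k rule: less_induct)
  case (less k)
  have k: "k > 0" using less.prems assms(3) by (auto intro!: Nat.gr0I)
  let ?B = "{d. d dvd k} - {k}"
  have split: "(\<Prod>d | d dvd k. h d) = h k * (\<Prod>d\<in>?B. h d)" for h :: "nat \<Rightarrow> 'a"
    using k by (intro prod.remove) auto
  have "f d = g d" if "d \<in> ?B" for d
  proof (rule less.IH)
    have "d dvd k" "d \<noteq> k" using that by auto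
    thus "d < k" using k by (meson dvd_imp_le le_neq_implies_less)
    show "d dvd n" using \<open>d dvd k\<close> less.prems by (rule dvd_trans)
  qed
  hence "(\<Prod>d\<in>?B. f d) = (\<Prod>d\<in>?B. g d)" by (intro prod.cong) auto
  with assms(1,2)[OF less.prems] show ?case by (simp add: split)
qed

text \<open>Primitive parts and cyclotomic values have the same divisor products, so they coincide
  at \<open>n\<close>; a primitive part other than 1 has a prime factor.\<close>

lemma primitive_prime_exists:
  assumes "n \<ge> 2" "coprime (2 ^ n - 1) n"
  obtains p :: nat where "prime p" "ord p 2 = n"
proof -
  have n: "n > 0" using assms by simp
  have kpos: "k > 0" if "k dvd n" for k using that n by (auto intro!: Nat.gr0I)
  have gt: "(2::nat) ^ k > 1" if "k > 0" for k using that by (rule one_less_power[rotated]) simp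
  have P: "(\<Prod>d | d dvd k. complex_of_nat (primitive_part d)) = 2 ^ k - 1" if k: "k dvd n" for k
  proof -
    have "(2::nat) ^ k - 1 dvd 2 ^ n - 1"
    proof -
      have "int (2 ^ k - 1) dvd int (2 ^ n - 1)"
        using k dvd_pow2_mult_minus_1 by (auto simp: of_nat_diff)
      thus ?thesis by (simp only: int_dvd_int_iff)
    qed
    with assms(2) k have "coprime (2 ^ k - 1) k" by (meson coprime_divisors)
    hence "complex_of_nat (\<Prod>d | d dvd k. primitive_part d) = of_nat (2 ^ k - 1)"
      using prod_primitive_part[OF kpos[OF k]] by simp
    thus ?thesis by (simp add: of_nat_diff)
  qed
  have nz: "(2::complex) ^ k - 1 \<noteq> 0" if "k dvd n" for k
  proof -
    have "complex_of_nat (2 ^ k - 1) \<noteq> 0" using gt[OF kpos[OF that]] by (simp only: of_nat_eq_0_iff)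
    thus ?thesis by (simp add: of_nat_diff)
  qed
  have "complex_of_nat (primitive_part n) = cyclotomic_at_2 n"
  proof (rule divisor_prod_unique[OF _ _ n dvd_refl])
    fix k assume k: "k dvd n"
    show "(\<Prod>d | d dvd k. complex_of_nat (primitive_part d)) = (\<Prod>d | d dvd k. cyclotomic_at_2 d)"
      using P[OF k] prod_cyclotomic_at_2[OF kpos[OF k]] by (rule trans[OF _ sym])
    show "(\<Prod>d | d dvd k. complex_of_nat (primitive_part d)) \<noteq> 0"
      unfolding P[OF k] by (rule nz[OF k])
  qed
  hence "primitive_part n \<noteq> 1"
    using norm_cyclotomic_at_2_gt_1[OF assms(1)] by (metis less_irrefl norm_one of_nat_1)
  hence "{p :: nat. p \<in> prime_factors (2 ^ n - 1) \<and> ord p 2 = n} \<noteq> {}"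
    unfolding primitive_part_def by (intro notI) (simp only: prod.empty simp_thms)
  thus ?thesis using that by auto
qed

section \<open>The two directions of the equivalence\<close>

lemma not_coprimeE_prime:
  fixes a b :: nat
  assumes "\<not> coprime a b"
  obtains p where "prime p" "p dvd a" "p dvd b"
proof -
  have "gcd a b \<noteq> 1" using assms by (simp only: coprime_iff_gcd_eq_1 not_False_eq_True)
  then obtain p where "prime p" "p dvd gcd a b" using prime_factor_nat by blast
  thus ?thesis using that by simp
qed

text \<open>The bound excludes \<open>n = 1\<close>, where the empty sum satisfies the congruence
  modulo 1 although 1 is not prime.\<close>

theorem theorem4p3:
  fixes n :: nat
  assumes "n \<ge> 2"
  shows "[(\<Sum>k = 1..n - 1. (2 ^ (k * n) - 1) div (2 ^ k - 1)) = (0 :: int)] (mod (2 ^ n - 1)) \<longleftrightarrow> prime n"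
proof
  assume n: "prime n"
  \<comment> \<open>For prime \<open>n\<close> every single summand is divisible:
    \<open>2 ^ n - 1\<close> divides \<open>2 ^ (k * n) - 1\<close> and is coprime to the
    denominator \<open>2 ^ k - 1\<close>.\<close>
  have "2 ^ n - 1 dvd ((2::int) ^ (k * n) - 1) div (2 ^ k - 1)" if k: "k \<in> {1..n-1}" for k
  proof -
    have "coprime k n" using n k
      by (subst coprime_commute) (intro prime_imp_coprime; auto dest: dvd_imp_le)
    have "coprime ((2::nat) ^ n - 1) (2 ^ k - 1)"
    proof (rule ccontr)
      assume "\<not> coprime ((2::nat) ^ n - 1) (2 ^ k - 1)"
      then obtain p :: nat where p: "prime p" "p dvd 2 ^ n - 1" "p dvd 2 ^ k - 1"
        by (rule not_coprimeE_prime)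
      hence "ord p 2 dvd 1" using \<open>coprime k n\<close>
        by (metis dvd_pow2_minus_1_iff coprime_common_divisor)
      hence "p dvd 2 ^ 1 - 1" by (simp only: dvd_pow2_minus_1_iff)
      thus False using p(1) by simp
    qed
    hence "coprime (int (2 ^ n - 1)) (int (2 ^ k - 1))" by (simp only: coprime_int_iff)
    hence "coprime ((2::int) ^ n - 1) (2 ^ k - 1)" by (simp add: of_nat_diff)
    moreover have "(2::int) ^ n - 1 dvd (2 ^ k - 1) * (\<Sum>j<n. (2 ^ k) ^ j)"
      using dvd_pow2_mult_minus_1[of n k]
      unfolding mult.commute[of n k] pow2_mult_minus_1[of k n] .
    ultimately show ?thesis using k
      by (subst pow2_quotient) (auto simp: coprime_dvd_mult_right_iff)
  qed
  thus "[(\<Sum>k = 1..n - 1. (2 ^ (k * n) - 1) div (2 ^ k - 1)) = (0 :: int)] (mod (2 ^ n - 1))"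
    by (auto simp: cong_0_iff intro!: dvd_sum)
next
  assume cong: "[(\<Sum>k = 1..n - 1. (2 ^ (k * n) - 1) div (2 ^ k - 1)) = (0 :: int)] (mod (2 ^ n - 1))"
  have odd: "odd p" if "p dvd 2 ^ k - 1" "k > 0" for p k :: nat
  proof
    assume "even p"
    hence "even ((2::nat) ^ k - 1)" using that(1) dvd_trans by blast
    thus False using that(2) by simp
  qed
  \<comment> \<open>A prime dividing both would exceed \<open>ord p 2\<close>, hence divide the
    cofactor \<open>m\<close>, but it also divides \<open>m - 1\<close>.\<close>
  have not_dvd: "\<not> p dvd n" if p: "prime p" "p dvd 2 ^ n - 1" for p :: nat
  proof
    assume "p dvd n"
    have "odd p" using odd p assms by auto
    obtain m where m: "n = ord p 2 * m"
      using p(2) unfolding dvd_pow2_minus_1_iff by (rule dvdE)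
    hence "m > 0" using assms by (cases m) auto
    have "p dvd m - 1"
      using prime_dvd_index_minus_1[OF cong p(1) \<open>odd p\<close> m] assms by simp
    have "\<not> p dvd ord p 2"
      using ord_two_less[OF p(1) \<open>odd p\<close>] by (auto dest: dvd_imp_le)
    hence "p dvd m" using \<open>p dvd n\<close> m p(1) by (auto simp: prime_dvd_mult_iff)
    hence "p dvd m - (m - 1)" using \<open>p dvd m - 1\<close> by (rule dvd_diff_nat)
    thus False using \<open>m > 0\<close> p(1) by simp
  qed
  show "prime n"
  proof (rule ccontr)
    assume "\<not> prime n"
    \<comment> \<open>The larger factor is named \<open>d\<close>, so that a prime above
      \<open>d\<close> also exceeds \<open>c\<close>.\<close>
    then obtain c d where n: "n = d * c" "1 < c" "c \<le> d"
    proof -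
      obtain a b where ab: "n = a * b" "1 < a" "1 < b"
        using \<open>\<not> prime n\<close> assms prime_factor_nat[of n]
        by (metis One_nat_def Suc_1 dvdE less_eq_Suc_le mult.right_neutral nat_neq_iff
            not_less_eq_eq prime_gt_1_nat less_one mult_0_right not_numeral_le_zero)
      thus ?thesis using that[of a b] that[of b a] by (cases "b \<le> a") (auto simp: mult.commute)
    qed
    have "coprime (2 ^ d - 1) d"
    proof (rule ccontr)
      assume "\<not> coprime (2 ^ d - 1) d"
      then obtain p :: nat where p: "prime p" "p dvd 2 ^ d - 1" "p dvd d"
        by (rule not_coprimeE_prime)
      thus False using not_dvd[of p] n(1) by (simp add: dvd_pow2_minus_1_iff del: One_nat_def)
    qed
    moreover have "d \<ge> 2" using n by simp
    ultimately obtain p :: nat where p: "prime p" "ord p 2 = d"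
      using primitive_prime_exists by blast
    have "p dvd 2 ^ d - 1" using p by (simp add: dvd_pow2_minus_1_iff del: One_nat_def)
    hence "odd p" using odd \<open>d \<ge> 2\<close> by auto
    have "p dvd c - 1"
      using prime_dvd_index_minus_1[OF cong p(1) \<open>odd p\<close>] n p(2) assms by simp
    \<comment> \<open>Since \<open>c - 1\<close> is positive, \<open>p < c\<close>, against
      \<open>c \<le> d = ord p 2 < p\<close>.\<close>
    hence "p \<le> c - 1" using n(2) by (intro dvd_imp_le) auto
    thus False using ord_two_less(2)[OF p(1) \<open>odd p\<close>] p(2) n by linarith
  qed
qed

end
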